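(* There exist an odd positive integer $M$ and an integer $\alpha$ such that the residue class $\{x\in\mathbb{Z}:\ x\equiv\alpha\pmod{M}\}$ contains no integer of the form $p^2+b^2-2^n$ with $p$ prime and $b,n\in\mathbb{N}$.
   Context: $\mathbb{N}=\{0,1,2,\ldots\}$. *)

theory Defs
  imports "HOL-Number_Theory.Number_Theory"
begin

end

theory Submission
  imports Defs "HOL-Library.Code_Binary_Nat"
begin

text \<open>
  If a prime \<open>q \<equiv> 3 (mod 4)\<close> divides \<open>x + 2\<^sup>n = p\<^sup>2 + b\<^sup>2\<close> then \<open>p = q\<close> and \<open>q\<^sup>2\<close> divides \<open>x + 2\<^sup>n\<close>.
  For \<open>x \<equiv> 4 (mod 15)\<close> and \<open>n\<close> odd, \<open>q = 3\<close> divides \<open>x + 2\<^sup>n\<close>, while \<open>x + 2\<^sup>n - 9\<close> is a nonsquare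
  modulo \<open>5\<close>. For \<open>n = 2 k\<close>, a covering system of classes \<open>a (mod m)\<close> for \<open>k\<close> is used, each with its own
  prime \<open>q \<equiv> 3 (mod 4)\<close> dividing \<open>4\<^sup>m - 1\<close>. Taking \<open>x \<equiv> - 4\<^sup>a (mod q\<^sup>2)\<close>, the condition that \<open>q\<^sup>2\<close> divides
  \<open>x + 4\<^sup>k\<close> forces \<open>k \<equiv> a (mod m q)\<close>, and this single remaining class is excluded by a further modulus
  \<open>R\<close> dividing \<open>4\<close> to the power \<open>m q\<close> minus \<open>1\<close>, modulo which \<open>x + 4\<^sup>a - q\<^sup>2\<close> is chosen to be a nonsquare.
  (If \<open>q\<^sup>2\<close> divides \<open>4\<^sup>m - 1\<close>, taking \<open>x \<equiv> q - 4\<^sup>a (mod q\<^sup>2)\<close> excludes the whole class \<open>a (mod m)\<close> at once.)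
\<close>


section \<open>Sums of two squares, nonsquares and primes congruent to 3 modulo 4\<close>

text \<open>Otherwise \<open>q\<close> divides neither number, and raising \<open>a\<^sup>2\<close>
  = \<open>- b\<^sup>2\<close> to the odd power \<open>(q - 1) div 2\<close> turns Fermat's theorem
  into 1 = -1 modulo \<open>q\<close>.\<close>

lemma prime_3_mod_4_dvd_sum_squares:
  fixes q a b :: nat
  assumes q: "prime q" "q mod 4 = 3" and dvd: "q dvd a\<^sup>2 + b\<^sup>2"
  shows "q dvd a"
proof (rule ccontr)
  assume na: "\<not> q dvd a"
  have nb: "\<not> q dvd b"
  proof
    assume "q dvd b"
    hence "q dvd b\<^sup>2" by (simp add: power2_eq_square)
    hence "q dvd a\<^sup>2" using dvd dvd_add_left_iff by blast
    with na q(1) show False using prime_dvd_power by blast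
  qed
  define h where "h = (q - 1) div 2"
  have h: "odd h" "q - 1 = 2 * h"
    using q(2) unfolding h_def by presburger+
  have "[(a\<^sup>2) ^ h + (b\<^sup>2) ^ h = 0] (mod q)"
  proof -
    have "[int a ^ 2 = - (int b ^ 2)] (mod int q)"
      using dvd by (metis cong_iff_dvd_diff diff_minus_eq_add of_nat_add of_nat_dvd_iff of_nat_power)
    hence "[(int a ^ 2) ^ h = (- (int b ^ 2)) ^ h] (mod int q)" by (rule cong_pow)
    hence "int q dvd (int a ^ 2) ^ h + (int b ^ 2) ^ h"
      using h(1) by (simp add: cong_iff_dvd_diff)
    hence "int q dvd int ((a\<^sup>2) ^ h + (b\<^sup>2) ^ h)" by simp
    thus ?thesis by (simp only: int_dvd_int_iff cong_0_iff)
  qed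
  moreover have "[(a\<^sup>2) ^ h + (b\<^sup>2) ^ h = 1 + 1] (mod q)"
    using fermat_theorem[OF q(1) na] fermat_theorem[OF q(1) nb] h(2)
    by (intro cong_add) (simp_all add: power_mult)
  ultimately have "[2 = 0] (mod q)" by (metis cong_sym cong_trans one_add_one)
  hence "q dvd 2" by (simp add: cong_0_iff)
  hence "q \<le> 2" by (simp add: dvd_imp_le)
  with q(2) show False by (cases "q = 0 \<or> q = 1 \<or> q = 2") auto
qed

text \<open>Squaring identifies 1 and -1, so on the finite set of residues it is not injective and
  hence not surjective. This works for composite \<open>R\<close> too.\<close>

lemma ex_nonsquare_mod:
  fixes R :: nat
  assumes "odd R" "R > 1"
  shows "\<exists>s::int. \<forall>b. \<not> [b\<^sup>2 = s] (mod int R)"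
proof -
  define f where "f = (\<lambda>b::int. b\<^sup>2 mod int R)"
  have R: "R \<ge> 3" using assms by (cases "R = 2") auto
  have "f 1 = f (int R - 1)"
  proof -
    have "[int R - 1 = - 1] (mod int R)" by (simp add: cong_iff_dvd_diff)
    from cong_pow[OF this, of 2] show ?thesis by (simp add: f_def cong_def)
  qed
  hence "\<not> inj_on f {0..<int R}"
    using R inj_onD[of f "{0..<int R}" 1 "int R - 1"] by auto
  moreover have "f ` {0..<int R} \<subseteq> {0..<int R}" using R by (auto simp: f_def)
  ultimately have "f ` {0..<int R} \<noteq> {0..<int R}"
    by (metis eq_card_imp_inj_on finite_atLeastLessThan_int)
  with \<open>f ` _ \<subseteq> _\<close> obtain s where s: "s \<in> {0..<int R}" "s \<notin> f ` {0..<int R}" by blast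
  have "\<not> [b\<^sup>2 = s] (mod int R)" for b
  proof
    assume "[b\<^sup>2 = s] (mod int R)"
    hence "f (b mod int R) = s" using s(1) by (simp add: f_def cong_def power_mod)
    moreover have "b mod int R \<in> {0..<int R}" using R by simp
    ultimately show False using s(2) by blast
  qed
  thus ?thesis by blast
qed

text \<open>Removing a prime factor that is 1 modulo 4 leaves a smaller cofactor that is still 3
  modulo 4.\<close>

lemma ex_prime_factor_3_mod_4:
  fixes N :: nat
  assumes "N mod 4 = 3"
  shows "\<exists>q. prime q \<and> q dvd N \<and> q mod 4 = 3"
  using assms
proof (induction N rule: less_induct)
  case (less N)
  hence "N \<noteq> 1" by auto
  then obtain p where p: "prime p" "p dvd N" using prime_factor_nat by blast
  then obtain c where c: "N = p * c" by blast
  have "odd N" using less.prems by presburger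
  hence "odd p" using p(2) by (metis dvd_trans)
  hence "p mod 4 = 1 \<or> p mod 4 = 3" by presburger
  thus ?case
  proof
    assume "p mod 4 = 1"
    hence "c mod 4 = 3" using less.prems c by (metis mod_mult_left_eq mult_1)
    moreover have "c < N"
      using c p(1) less.prems prime_gt_1_nat[OF p(1)] by (cases "c = 0") auto
    ultimately show ?thesis using less.IH[of c] c by auto
  qed (use p in auto)
qed

section \<open>Orders and powers modulo prime squares\<close>

text \<open>Stated for twice the sum to avoid halving \<open>n (n - 1)\<close>.\<close>
lemma geometric_sum_mod:
  fixes A t :: int
  assumes "A = 1 + int q * t"
  shows "[2 * (\<Sum>i<n. A ^ i) = 2 * int n + int q * t * int n * (int n - 1)] (mod (int q)\<^sup>2)"
proof -
  have pow: "[A ^ i = 1 + int q * t * int i] (mod (int q)\<^sup>2)" for i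
  proof (induction i)
    case (Suc i)
    have "[A ^ Suc i = (1 + int q * t) * (1 + int q * t * int i)] (mod (int q)\<^sup>2)"
      using cong_mult[OF cong_refl Suc.IH, of A] assms by simp
    moreover have "(1 + int q * t) * (1 + int q * t * int i)
        = 1 + int q * t * int (Suc i) + (int q)\<^sup>2 * (t\<^sup>2 * int i)"
      by (simp add: algebra_simps power2_eq_square)
    ultimately show ?case by (simp add: cong_def)
  qed simp
  show ?thesis
  proof (induction n)
    case (Suc n)
    have "[2 * (\<Sum>i<n. A ^ i) + 2 * A ^ n = (2 * int n + int q * t * int n * (int n - 1))
            + 2 * (1 + int q * t * int n)] (mod (int q)\<^sup>2)"
      by (intro cong_add Suc.IH cong_mult cong_refl pow)
    thus ?case by (simp add: algebra_simps)
  qed simp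
qed

text \<open>Since \<open>q\<close> divides \<open>A - 1\<close> exactly once, the second factor
  \<open>q\<close> of \<open>A ^ n - 1\<close> lies in the geometric sum, which is \<open>n\<close>
  modulo \<open>q\<close>.\<close>

lemma prime_dvd_exponent:
  fixes A q n :: nat
  assumes q: "prime q" and A: "[A = 1] (mod q)" "\<not> [A = 1] (mod q\<^sup>2)"
    and pw: "[A ^ n = 1] (mod q\<^sup>2)"
  shows "q dvd n"
proof -
  from A(1) have "int q dvd int A - 1"
    by (metis cong_iff_dvd_diff cong_int_iff of_nat_1)
  then obtain t where t: "int A - 1 = int q * t" by blast
  have "\<not> int q dvd t"
  proof
    assume "int q dvd t"
    hence "(int q)\<^sup>2 dvd int A - 1" using t by (auto simp: power2_eq_square)
    with A(2) show False by (metis cong_iff_dvd_diff cong_int_iff of_nat_1 of_nat_power)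
  qed
  have "(int q)\<^sup>2 dvd int A ^ n - 1"
    using pw by (metis cong_iff_dvd_diff cong_int_iff of_nat_1 of_nat_power)
  hence "int q * int q dvd int q * (t * (\<Sum>i<n. int A ^ i))"
    using power_diff_1_eq[of "int A" n] t by (simp add: power2_eq_square mult.assoc)
  hence "int q dvd t * (\<Sum>i<n. int A ^ i)"
    using q by (simp add: prime_gt_0_nat)
  hence "int q dvd (\<Sum>i<n. int A ^ i)"
    using \<open>\<not> int q dvd t\<close> q by (simp add: prime_dvd_mult_iff)
  moreover have "[(\<Sum>i<n. int A ^ i) = (\<Sum>i<n. 1 ^ i)] (mod int q)"
    using t by (intro cong_sum cong_pow) (simp add: cong_iff_dvd_diff)
  hence "int q dvd (\<Sum>i<n. int A ^ i) \<longleftrightarrow> int q dvd (\<Sum>i<n. 1 ^ i)"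
    by (rule cong_dvd_iff)
  ultimately have "int q dvd int n" by simp
  thus ?thesis by simp
qed

text \<open>The quotient \<open>S\<close> of \<open>A ^ q - 1\<close> by \<open>A - 1\<close> is
  \<open>q\<close> modulo \<open>A - 1\<close>, so a common prime factor can only be
  \<open>q\<close>. As \<open>q\<close> is odd, \<open>q\<close> divides \<open>S\<close> exactly
  once, and \<open>R\<close> is \<open>S\<close> divided by \<open>q\<close>.\<close>

lemma ex_new_factor:
  fixes A q :: nat
  assumes q: "prime q" "odd q" and A: "[A = 1] (mod q)" "A > 1"
  shows "\<exists>R>1. R dvd A ^ q - 1 \<and> coprime R (A - 1)"
proof -
  define S where "S = (\<Sum>i<q. A ^ i)"
  obtain t where t: "A - 1 = q * t"
    using A by (metis cong_altdef_nat less_imp_le_nat dvdE)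
  have prod: "(A - 1) * S = A ^ q - 1"
  proof -
    have "int ((A - 1) * S) = int (A ^ q - 1)"
      using power_diff_1_eq[of "int A" q] A(2) unfolding S_def by (simp add: of_nat_diff)
    thus ?thesis by (simp only: of_nat_eq_iff)
  qed
  have S_cong: "[S = q] (mod (A - 1))"
  proof -
    have "[A = 1] (mod (A - 1))" using A(2) by (simp add: cong_altdef_nat)
    hence "[S = (\<Sum>i<q. 1 ^ i)] (mod (A - 1))" unfolding S_def by (intro cong_sum cong_pow)
    thus ?thesis by simp
  qed
  have "q dvd S"
  proof -
    have "[S = q] (mod q)" using S_cong t cong_dvd_modulus_nat[of S q "A - 1" q] by simp
    thus ?thesis by (simp add: cong_dvd_iff)
  qed
  then obtain R where R: "S = q * R" by blast
  have nq: "\<not> q dvd R"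
  proof
    assume "q dvd R"
    hence "(int q)\<^sup>2 dvd int S" using R by (auto simp: power2_eq_square)
    hence 1: "(int q)\<^sup>2 dvd 2 * int S" by simp
    have "A = 1 + q * t" using t A(2) by linarith
    hence "int A = 1 + int q * int t" by simp
    hence "[2 * int S = 2 * int q + int q * int t * int q * (int q - 1)] (mod (int q)\<^sup>2)"
      using geometric_sum_mod[of "int A" q "int t" q] unfolding S_def by simp
    hence "(int q)\<^sup>2 dvd 2 * int q + int q * int t * int q * (int q - 1)"
      using 1 cong_dvd_iff by blast
    moreover have "(int q)\<^sup>2 dvd int q * int t * int q * (int q - 1)"
      by (simp add: power2_eq_square)
    ultimately have "(int q)\<^sup>2 dvd 2 * int q"
      using dvd_add_left_iff by blast
    hence "int q * int q dvd int q * 2" by (simp add: power2_eq_square mult.commute)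
    hence "int q dvd int 2" using q(1) prime_gt_0_nat by auto
    hence "q dvd 2" by (simp only: int_dvd_int_iff)
    hence "q = 2" using q(1) two_is_prime_nat primes_dvd_imp_eq by blast
    thus False using q(2) by simp
  qed
  have "R > 1"
  proof -
    have "\<exists>i\<in>{..<q}. 1 < A ^ i"
      using A(2) prime_gt_1_nat[OF q(1)] by (intro bexI[of _ 1]) auto
    moreover have "\<forall>i\<in>{..<q}. 1 \<le> A ^ i" using A(2) by simp
    ultimately have "(\<Sum>i<q. 1) < S" unfolding S_def by (intro sum_strict_mono_ex1) auto
    thus ?thesis using R by (cases "R = 0 \<or> R = 1") auto
  qed
  moreover have "R dvd A ^ q - 1" unfolding prod[symmetric] R by simp
  moreover have "coprime R (A - 1)"
  proof (rule ccontr)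
    assume "\<not> coprime R (A - 1)"
    then obtain r where r: "prime r" "r dvd R" "r dvd A - 1"
      by (metis coprime_iff_gcd_eq_1 gcd_nat.bounded_iff prime_factor_nat)
    hence "r dvd q" using S_cong R
      by (metis cong_dvd_iff cong_dvd_modulus_nat dvd_mult)
    with r q nq show False using primes_dvd_imp_eq by blast
  qed
  ultimately show ?thesis by blast
qed

text \<open>A common prime \<open>r\<close> would make the order of \<open>A\<close> modulo
  \<open>r\<close> divide both \<open>m * q\<close> and \<open>e\<close>, hence \<open>m\<close>,
  against the coprimality of \<open>R\<close> and \<open>A ^ m - 1\<close>.\<close>

lemma coprime_power_minus_one:
  fixes A m q e R :: nat
  assumes R: "R dvd A ^ (m * q) - 1" "coprime R (A ^ m - 1)" and "coprime q e" and A: "A > 0"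
  shows "coprime R (A ^ e - 1)"
proof (rule ccontr)
  assume "\<not> coprime R (A ^ e - 1)"
  then obtain r where r: "prime r" "r dvd R" "r dvd A ^ e - 1"
    by (metis coprime_iff_gcd_eq_1 gcd_nat.bounded_iff prime_factor_nat)
  have ord: "r dvd A ^ j - 1 \<longleftrightarrow> ord r A dvd j" for j
    using A ord_divides[of A j r] by (simp add: cong_altdef_nat)
  have "ord r A dvd m * q" "ord r A dvd e" using r R(1) ord dvd_trans by blast+
  hence "ord r A dvd m"
    using \<open>coprime q e\<close> by (metis coprime_commute coprime_divisors coprime_dvd_mult_left_iff dvd_refl)
  hence "r dvd A ^ m - 1" using ord by blast
  with r R(2) show False by (metis coprime_common_divisor_nat not_prime_1)
qed

lemma power_cong_exponent:
  fixes A :: nat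
  assumes "[A ^ m = 1] (mod Q)" "k mod m = a mod m"
  shows "[A ^ k = A ^ a] (mod Q)"
proof -
  have "[A ^ j = A ^ (j mod m)] (mod Q)" for j
  proof -
    have "A ^ j = (A ^ m) ^ (j div m) * A ^ (j mod m)"
      by (simp flip: power_mult power_add)
    moreover have "[(A ^ m) ^ (j div m) = 1 ^ (j div m)] (mod Q)"
      using assms(1) by (rule cong_pow)
    ultimately show ?thesis
      using cong_mult[OF _ cong_refl, of "(A ^ m) ^ (j div m)" 1 Q "A ^ (j mod m)"] by simp
  qed
  from this[of k] this[of a] show ?thesis using assms(2) by (simp add: cong_def)
qed

text \<open>The congruence modulo \<open>q\<^sup>2\<close> forces \<open>q\<close> to divide the
  quotient of \<open>k - a\<close> by \<open>m\<close>, so the exponents agree modulo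
  \<open>m * q\<close>.\<close>

lemma power_cong_lift:
  fixes A q m R :: nat
  assumes q: "prime q" "coprime A q" and Am: "[A ^ m = 1] (mod q)" "\<not> [A ^ m = 1] (mod q\<^sup>2)"
    and R: "[A ^ (m * q) = 1] (mod R)"
    and k: "k mod m = a mod m" "[A ^ k = A ^ a] (mod q\<^sup>2)"
  shows "[A ^ k = A ^ a] (mod R)"
  using k
proof (induction a k rule: linorder_wlog)
  case (le a k)
  then obtain t where t: "k = a + m * t"
    by (metis le_add_diff_inverse mod_eq_dvd_iff_nat dvdE)
  have "[A ^ a * (A ^ m) ^ t = A ^ a * 1] (mod q\<^sup>2)"
    using le(3) by (simp add: t power_add power_mult)
  moreover have "coprime (A ^ a) (q\<^sup>2)" using q(2) by simp
  ultimately have "[(A ^ m) ^ t = 1] (mod q\<^sup>2)" by (simp only: cong_mult_lcancel_nat)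
  hence "q dvd t" using prime_dvd_exponent[OF q(1) Am] by blast
  then obtain t' where "t = q * t'" by blast
  hence "k mod (m * q) = a mod (m * q)" using t by (simp flip: mult.assoc)
  thus ?case using R power_cong_exponent by blast
next
  case (sym a k)
  thus ?case by (metis cong_sym)
qed

section \<open>Residues that exclude even and odd exponents\<close>

text \<open>Both cases for \<open>q\<^sup>2\<close> are treated, so that no entry of the cover has
  to be checked for \<open>q\<^sup>2\<close> dividing \<open>4 ^ m - 1\<close>. The residue
  \<open>u\<close> is a natural number, as \<open>chinese_remainder_nat\<close> expects.\<close>

lemma ex_residue_even_class:
  fixes q m a R :: nat
  assumes q: "prime q" "q mod 4 = 3" "[4 ^ m = 1] (mod q)"
    and R: "odd R" "R > 1" "[4 ^ (m * q) = 1] (mod R)" and cop: "coprime q R"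
  shows "\<exists>u::nat. \<forall>x k p b. [x = int u] (mod int (q\<^sup>2 * R)) \<longrightarrow> k mod m = a mod m \<longrightarrow>
           prime p \<longrightarrow> x + 4 ^ k \<noteq> int p ^ 2 + int b ^ 2"
proof -
  obtain s where s: "\<And>b. \<not> [b\<^sup>2 = s] (mod int R)"
    using ex_nonsquare_mod[OF R(1,2)] by blast
  define u0 :: int where "u0 = (if [4 ^ m = 1] (mod q\<^sup>2) then int q - 4 ^ a else - (4 ^ a))"
  obtain w where w: "[w = u0] (mod int (q\<^sup>2))" "[w = s - 4 ^ a + int q ^ 2] (mod int R)"
    using binary_chinese_remainder_int[of "int (q\<^sup>2)" "int R"] cop by auto
  define u where "u = nat (w mod int (q\<^sup>2 * R))"
  have qR: "q\<^sup>2 * R > 0" using q(1) R(2) prime_gt_0_nat by simp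
  hence u: "int u = w mod int (q\<^sup>2 * R)" unfolding u_def by simp
  have "x + 4 ^ k \<noteq> int p ^ 2 + int b ^ 2"
    if x: "[x = int u] (mod int (q\<^sup>2 * R))" and k: "k mod m = a mod m" and p: "prime p" for x k p b
  proof
    assume eq: "x + 4 ^ k = int p ^ 2 + int b ^ 2"
    have "[x = w] (mod int (q\<^sup>2 * R))" using x unfolding u by (simp add: cong_def)
    hence "[x = w] (mod int (q\<^sup>2))" "[x = w] (mod int R)"
      by (auto elim: cong_dvd_modulus)
    with w have xq: "[x = u0] (mod int (q\<^sup>2))" and xR: "[x = s - 4 ^ a + int q ^ 2] (mod int R)"
      using cong_trans by blast+
    have int_pow: "[(4::int) ^ k = 4 ^ a] (mod int Q)" if "[(4::nat) ^ k = 4 ^ a] (mod Q)" for Q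
      using that by (simp flip: cong_int_iff)
    have "[x = u0] (mod int q)" using xq by (rule cong_dvd_modulus) simp
    \<comment> \<open>Both possible values of \<open>u0\<close> agree modulo \<open>q\<close>, so
      \<open>p = q\<close> follows before any case distinction.\<close>
    moreover have "[u0 = - (4 ^ a)] (mod int q)" unfolding u0_def by (simp add: cong_iff_dvd_diff)
    ultimately have "[x + 4 ^ k = - (4 ^ a) + 4 ^ a] (mod int q)"
      using int_pow[OF power_cong_exponent[OF q(3) k]] by (intro cong_add) (auto intro: cong_trans)
    hence "int q dvd int (p\<^sup>2 + b\<^sup>2)" by (simp add: eq cong_0_iff)
    hence dvd: "q dvd p\<^sup>2 + b\<^sup>2" by (simp only: int_dvd_int_iff)
    have "q dvd p" using prime_3_mod_4_dvd_sum_squares[OF q(1,2) dvd] .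
    hence pq: "p = q" using p q(1) primes_dvd_imp_eq by blast
    have "q dvd b"
      using prime_3_mod_4_dvd_sum_squares[OF q(1,2), of b p] dvd by (simp add: add.commute)
    hence "q\<^sup>2 dvd p\<^sup>2 + b\<^sup>2" using pq by simp
    hence "int (q\<^sup>2) dvd int (p\<^sup>2 + b\<^sup>2)" by (simp only: int_dvd_int_iff)
    hence sq: "int (q\<^sup>2) dvd x + 4 ^ k" by (simp add: eq)
    show False
    proof (cases "[4 ^ m = 1] (mod q\<^sup>2)")
      case True
      have "[x + 4 ^ k = int q - 4 ^ a + 4 ^ a] (mod int (q\<^sup>2))"
        using xq True int_pow[OF power_cong_exponent[OF True k]] unfolding u0_def
        by (intro cong_add) simp_all
      hence "int (q\<^sup>2) dvd int q" using sq by (simp add: cong_dvd_iff)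
      hence "q\<^sup>2 dvd q" by (simp only: int_dvd_int_iff)
      hence "q\<^sup>2 \<le> q" using q(1) prime_gt_0_nat dvd_imp_le by blast
      thus False using prime_gt_1_nat[OF q(1)] by (simp add: power2_eq_square)
    next
      case False
      have "[x + 4 ^ k = - (4 ^ a) + 4 ^ k] (mod int (q\<^sup>2))"
        using xq False unfolding u0_def by (intro cong_add) simp_all
      hence "int (q\<^sup>2) dvd - (4 ^ a) + 4 ^ k" using sq by (simp only: cong_dvd_iff)
      hence "[int (4 ^ k) = int (4 ^ a)] (mod int (q\<^sup>2))" by (simp add: cong_iff_dvd_diff)
      hence "[4 ^ k = 4 ^ a] (mod q\<^sup>2)" by (simp only: cong_int_iff)
      moreover have "coprime 4 q"
      proof -
        have "odd q" using q(2) by presburger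
        hence "coprime (2 ^ 2) q" by (subst coprime_power_left_iff) simp
        thus ?thesis by simp
      qed
      ultimately have "[4 ^ k = 4 ^ a] (mod R)"
        using power_cong_lift[OF q(1) _ q(3) False R(3) k] by blast
      hence "[x + 4 ^ k - int q ^ 2 = (s - 4 ^ a + int q ^ 2) + 4 ^ a - int q ^ 2] (mod int R)"
        using int_pow xR by (intro cong_diff cong_add cong_refl) auto
      moreover have "x + 4 ^ k - int q ^ 2 = int b ^ 2" using eq pq by simp
      ultimately have "[int b ^ 2 = s] (mod int R)" by simp
      with s show False by blast
    qed
  qed
  thus ?thesis by blast
qed

lemma odd_exponent:
  fixes x :: int
  assumes x: "[x = 4] (mod 15)" and n: "odd n" and p: "prime p"
  shows "x + 2 ^ n \<noteq> int p ^ 2 + int b ^ 2"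
proof
  assume eq: "x + 2 ^ n = int p ^ 2 + int b ^ 2"
  obtain k where k: "n = 2 * k + 1" using n by (elim oddE)
  have n4: "(2::int) ^ n = 4 ^ k * 2" by (simp add: k power_mult)
  have "[4 ^ k * 2 = 1 ^ k * (2::int)] (mod 3)"
    by (intro cong_mult cong_pow cong_refl) (simp add: cong_def)
  moreover have "[x = 4] (mod 3)" using x by (rule cong_dvd_modulus) simp
  ultimately have "[x + 2 ^ n = 4 + 2] (mod 3)" unfolding n4 by (intro cong_add) simp_all
  hence "int 3 dvd int (p\<^sup>2 + b\<^sup>2)" by (simp add: eq cong_def mod_0_imp_dvd)
  hence "3 dvd p\<^sup>2 + b\<^sup>2" by (simp only: int_dvd_int_iff)
  hence "3 dvd p" using prime_3_mod_4_dvd_sum_squares[of 3 p b] by simp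
  hence p3: "p = 3" using p primes_dvd_imp_eq[of 3 p] by simp
  have "[4 ^ k * 2 = (- 1) ^ k * (2::int)] (mod 5)"
    by (intro cong_mult cong_pow cong_refl) (simp add: cong_def)
  moreover have "[x = 4] (mod 5)" using x by (rule cong_dvd_modulus) simp
  ultimately have "[x + 2 ^ n - 9 = 4 + (- 1) ^ k * 2 - 9] (mod 5)"
    unfolding n4 by (intro cong_add cong_diff cong_refl)
  moreover have "x + 2 ^ n - 9 = int b ^ 2" using eq p3 by simp
  \<comment> \<open>The values are -3 for even \<open>k\<close> and -7 for odd \<open>k\<close>; 2
    and 3 are exactly the nonsquares modulo 5.\<close>
  ultimately have "int b ^ 2 mod 5 \<in> {2, 3}"
    by (cases "even k") (simp_all add: cong_def)
  hence "(int b mod 5) ^ 2 mod 5 \<in> {2, 3}" by (simp add: power_mod)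
  moreover have "int b mod 5 \<in> {0, 1, 2, 3, 4}" by auto
  ultimately show False by auto
qed

section \<open>The covering system and its primes\<close>

lemma four_power_minus_one_dvd:
  fixes r :: nat
  shows "[4 ^ e = 1] (mod r) \<longleftrightarrow> r dvd 4 ^ e - 1"
  by (simp add: cong_altdef_nat)

text \<open>
  A triple \<open>(a, m, N)\<close> stands for the class \<open>a (mod m)\<close> and a divisor \<open>N\<close> of \<open>4\<^sup>m - 1\<close>. Since
  \<open>N \<equiv> 3 (mod 4)\<close>, some prime factor of \<open>N\<close> is \<open>3\<close> modulo \<open>4\<close>, so \<open>N\<close> itself need not be prime.
  The moduli divide \<open>945 = 3\<^sup>3 \<cdot> 5 \<cdot> 7\<close>.
\<close>
definition cover :: "(nat \<times> nat \<times> nat) list" where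
  "cover =
    [(0, 3, 7), (2, 5, 11), (1, 5, 31), (2, 7, 43), (6, 7, 127), (1, 9, 19), (14, 15, 151),
     (5, 15, 331), (5, 21, 5419), (16, 27, 87211), (18, 35, 71), (28, 35, 86171), (4, 45, 631),
     (40, 45, 23311), (38, 105, 211), (8, 105, 29191), (25, 135, 271), (133, 135, 811),
     (34, 135, 348031), (79, 135, 385838642647891), (115, 189, 379), (169, 189, 119827),
     (61, 189, 1560007), (7, 189, 207617485544258392970753527), (148, 315, 870031),
     (103, 315, 983431), (283, 315, 1765891), (655, 945, 69931)]"

text \<open>\<open>mod_exp\<close> lets the evaluation reduce modulo \<open>N\<close> instead of
  expanding \<open>4 ^ m\<close>. The entry with \<open>N = 7\<close> is singled out because 7
  divides 945.\<close>

lemma cover_moduli: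
  "list_all (\<lambda>(a, m, N). N mod 4 = 3 \<and> m dvd 945 \<and> mod_exp 4 m N = 1 \<and>
     (N = 7 \<and> m = 3 \<or> coprime N 945)) cover"
  by code_simp

lemma cover_coprime: "sorted_wrt coprime (map (\<lambda>(a, m, N). N) cover)"
  by code_simp

text \<open>One period decides all exponents, since every modulus divides 945.\<close>

lemma cover_covers: "list_all (\<lambda>k. list_ex (\<lambda>(a, m, N). k mod m = a) cover) [0..<945]"
  by code_simp

lemma ex_cover_class: "\<exists>(a, m, N)\<in>set cover. k mod m = a mod m"
proof -
  have "list_ex (\<lambda>(a, m, N). k mod 945 mod m = a) cover"
    using cover_covers by (simp add: list_all_iff)
  then obtain a m N where i: "(a, m, N) \<in> set cover" "k mod 945 mod m = a"
    by (auto simp: list_ex_iff)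
  moreover have "m dvd 945" using cover_moduli i(1) by (auto simp: list_all_iff)
  ultimately have "k mod m = a mod m" by (auto simp: mod_mod_cancel)
  with i(1) show ?thesis by blast
qed

text \<open>The primes are chosen as prime factors of the \<open>N\<close>; they differ because the
  \<open>N\<close> are pairwise coprime.\<close>

lemma ex_cover_primes:
  "\<exists>q. (\<forall>i\<in>set cover. prime (q i) \<and> q i mod 4 = 3 \<and> [4 ^ fst (snd i) = 1] (mod q i) \<and>
        fst (snd i) dvd 945 \<and> (q i = 7 \<and> fst (snd i) = 3 \<or> coprime (q i) 945)) \<and>
      (\<forall>i\<in>set cover. \<forall>j\<in>set cover. i \<noteq> j \<longrightarrow> q i \<noteq> (q j :: nat))"
proof -
  have "\<forall>N::nat. \<exists>q. N mod 4 = 3 \<longrightarrow> prime q \<and> q dvd N \<and> q mod 4 = 3"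
    using ex_prime_factor_3_mod_4 by blast
  then obtain q :: "nat \<Rightarrow> nat"
    where q: "\<And>N. N mod 4 = 3 \<Longrightarrow> prime (q N) \<and> q N dvd N \<and> q N mod 4 = 3"
    by metis
  have item: "prime (q N) \<and> q N dvd N \<and> q N mod 4 = 3 \<and> [4 ^ m = 1] (mod q N) \<and>
      m dvd 945 \<and> (q N = 7 \<and> m = 3 \<or> coprime (q N) 945)" if i: "(a, m, N) \<in> set cover" for a m N
  proof -
    have N: "N mod 4 = 3" "m dvd 945" "4 ^ m mod N = 1" "N = 7 \<and> m = 3 \<or> coprime N 945"
      using cover_moduli i by (auto simp: list_all_iff mod_exp_def)
    have "N \<noteq> 1" using N(1) by auto
    hence "[4 ^ m = 1] (mod N)" using N(3) by (simp add: cong_def)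
    hence "[4 ^ m = 1] (mod q N)" using q[OF N(1)] cong_dvd_modulus_nat by blast
    moreover have "q N = 7 \<and> m = 3 \<or> coprime (q N) 945"
    proof (cases "N = 7 \<and> m = 3")
      case True
      have "prime (7::nat)" by simp
      hence "q N = 7" using True q[OF N(1)] primes_dvd_imp_eq by blast
      thus ?thesis using True by blast
    next
      case False
      hence "coprime N 945" using N(4) by blast
      thus ?thesis using coprime_divisors[of "q N" N 945 945] q[OF N(1)] by simp
    qed
    ultimately show ?thesis using N(2) q[OF N(1)] by blast
  qed
  have distinct: "q (snd (snd i)) \<noteq> q (snd (snd j))"
    if ij: "i \<in> set cover" "j \<in> set cover" "i \<noteq> j" for i j
  proof -
    define n where "n = (\<lambda>i. snd (snd (cover ! i)))"
    obtain i' j' where i'j': "i' < length cover" "j' < length cover" "cover ! i' = i" "cover ! j' = j"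
      using ij(1,2) by (auto simp: in_set_conv_nth)
    have "coprime (n i') (n j')" if "i' < j'" "j' < length cover" for i' j'
      using cover_coprime that unfolding n_def
      by (auto simp: sorted_wrt_iff_nth_less split_beta)
    hence "coprime (n i') (n j')"
      using i'j' ij(3) by (metis coprime_commute nat_neq_iff)
    hence "coprime (snd (snd i)) (snd (snd j))" unfolding n_def using i'j' by simp
    moreover have "prime (q (snd (snd i)))" "q (snd (snd i)) dvd snd (snd i)"
      "q (snd (snd j)) dvd snd (snd j)"
      using item ij(1,2) by (metis prod.collapse)+
    ultimately show ?thesis by (metis coprime_common_divisor_nat not_prime_1)
  qed
  show ?thesis
  proof (intro exI[of _ "\<lambda>i. q (snd (snd i))"] conjI ballI impI)
    fix i assume "i \<in> set cover"
    thus "prime (q (snd (snd i)))" "q (snd (snd i)) mod 4 = 3"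
      "[4 ^ fst (snd i) = 1] (mod q (snd (snd i)))" "fst (snd i) dvd 945"
      "q (snd (snd i)) = 7 \<and> fst (snd i) = 3 \<or> coprime (q (snd (snd i))) 945"
      using item[of "fst i" "fst (snd i)" "snd (snd i)"] by simp_all
  qed (use distinct in blast)
qed

section \<open>Pairwise coprime moduli for the classes\<close>

text \<open>
  If \<open>q\<close> divides no modulus of the cover, then every prime factor of the new factor of
  \<open>(4\<^sup>m)\<^sup>q - 1\<close> has an order divisible by \<open>q\<close>, which separates the \<open>R\<close>'s. This fails only for \<open>q = 7\<close>,
  where \<open>R = 337\<close>, for which \<open>4\<close> has order \<open>21 = 3 \<cdot> 7\<close>.
\<close>
lemma ex_coprime_moduli:
  "\<exists>q R. (\<forall>i\<in>set cover. prime (q i) \<and> q i mod 4 = 3 \<and> [4 ^ fst (snd i) = 1] (mod q i) \<and>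
          odd (R i) \<and> R i > 1 \<and> [4 ^ (fst (snd i) * q i) = 1] (mod R i) \<and>
          coprime (q i) (R i) \<and> coprime (q i) 15 \<and> coprime (R i) 15) \<and>
      (\<forall>i\<in>set cover. \<forall>j\<in>set cover. i \<noteq> j \<longrightarrow>
          coprime (q i) (q j) \<and> coprime (q i) (R j) \<and> coprime (R i) (R j :: nat))"
proof -
  define m :: "nat \<times> nat \<times> nat \<Rightarrow> nat" where "m = (\<lambda>i. fst (snd i))"
  obtain q where q_all: "\<forall>i\<in>set cover. prime (q i) \<and> q i mod 4 = 3 \<and> [4 ^ m i = 1] (mod q i) \<and>
        m i dvd 945 \<and> (q i = 7 \<and> m i = 3 \<or> coprime (q i) 945)"
    and "\<forall>i\<in>set cover. \<forall>j\<in>set cover. i \<noteq> j \<longrightarrow> q i \<noteq> (q j :: nat)"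
    using ex_cover_primes unfolding m_def by (elim exE conjE)
  hence q_neq: "q i \<noteq> q j" if "i \<in> set cover" "j \<in> set cover" "i \<noteq> j" for i j
    using that by blast
  have q: "prime (q i)" "q i mod 4 = 3" "[4 ^ m i = 1] (mod q i)" "m i dvd 945"
      "q i = 7 \<and> m i = 3 \<or> coprime (q i) 945" if "i \<in> set cover" for i
    using q_all that by blast+
  \<comment> \<open>For \<open>q i = 7\<close> the general construction would give 43 * 127 * 337 *
    5419, which shares 43, 127 and 5419 with other entries of \<open>cover\<close>; only 337 is
    kept.\<close>
  have "\<forall>i\<in>set cover. \<exists>R::nat. R > 1 \<and> R dvd 4 ^ (m i * q i) - 1 \<and>
      (if q i = 7 then R = 337 else coprime R (4 ^ m i - 1))"
  proof
    fix i assume i: "i \<in> set cover"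
    show "\<exists>R::nat. R > 1 \<and> R dvd 4 ^ (m i * q i) - 1 \<and> (if q i = 7 then R = 337 else coprime R (4 ^ m i - 1))"
    proof (cases "q i = 7")
      case True
      moreover have "\<not> coprime (7::nat) 945" by (simp add: coprime_iff_gcd_eq_1 gcd_non_0_nat)
      ultimately have "m i = 3" using q(5)[OF i] by auto
      thus ?thesis using True by (intro exI[of _ 337]) simp
    next
      case False
      have "odd (q i)" using q(2)[OF i] by presburger
      moreover have "m i > 0" using q(4)[OF i] by (cases "m i = 0") auto
      hence "(4::nat) ^ m i > 1" by (intro one_less_power) simp_all
      ultimately obtain R :: nat where "R > 1" "R dvd (4 ^ m i) ^ q i - 1" "coprime R (4 ^ m i - 1)"
        using ex_new_factor[OF q(1)[OF i] _ q(3)[OF i]] by blast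
      thus ?thesis using False by (auto simp: power_mult)
    qed
  qed
  then obtain R :: "nat \<times> nat \<times> nat \<Rightarrow> nat" where R: "\<And>i. i \<in> set cover \<Longrightarrow> R i > 1"
      "\<And>i. i \<in> set cover \<Longrightarrow> R i dvd 4 ^ (m i * q i) - 1"
      "\<And>i. i \<in> set cover \<Longrightarrow> q i = 7 \<Longrightarrow> R i = 337"
      "\<And>i. i \<in> set cover \<Longrightarrow> q i \<noteq> 7 \<Longrightarrow> coprime (R i) (4 ^ m i - 1)"
    by metis
  have R_coprime: "coprime (R i) r"
    if "i \<in> set cover" "q i \<noteq> 7" "coprime (q i) e" "r dvd 4 ^ e - 1" for i e r
  proof -
    have "coprime (R i) (4 ^ e - 1)"
      using coprime_power_minus_one[OF R(2)[OF that(1)] R(4)[OF that(1,2)] that(3)] by simp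
    thus ?thesis using coprime_divisors[of "R i" "R i" r "4 ^ e - 1"] that(4) by simp
  qed
  have prime_coprime: "coprime a b" if "prime a" "prime b" "a \<noteq> b" for a b :: nat
    using that primes_coprime by blast
  have qm: "coprime (q i) (m j)" if "i \<in> set cover" "q i \<noteq> 7" "j \<in> set cover" for i j
    using coprime_divisors[of "q i" "q i" "m j" 945] q(5)[OF that(1)] q(4)[OF that(3)] that(2)
    by simp
  have p337: "prime (337::nat)" by code_simp
  have qR: "coprime (q i) (R j)" if "i \<in> set cover" "j \<in> set cover" for i j
  proof (cases "q j = 7")
    case True
    \<comment> \<open>337 is 1 modulo 4, whereas \<open>q i\<close> is 3.\<close>
    have "q i \<noteq> 337" using q(2)[OF that(1)] by auto
    thus ?thesis using prime_coprime[OF q(1)[OF that(1)] p337] R(3)[OF that(2) True] by simp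
  next
    case False
    have "q i dvd 4 ^ m i - 1" using q(3)[OF that(1)] four_power_minus_one_dvd by blast
    thus ?thesis
      using R_coprime[OF that(2) False qm[OF that(2) False that(1)]] coprime_commute by blast
  qed
  have RR: "coprime (R i) (R j)" if ij: "i \<in> set cover" "j \<in> set cover" "i \<noteq> j" for i j
  proof -
    have *: "coprime (R i) (R j)"
      if "i \<in> set cover" "j \<in> set cover" "i \<noteq> j" "q i \<noteq> 7" for i j
    proof -
      have "coprime (q i) (m j * q j)"
        using qm[of i j] prime_coprime[OF q(1) q(1)] q_neq that by simp
      thus ?thesis using R_coprime R(2) that by blast
    qed
    \<comment> \<open>At most one of two distinct primes is 7, so \<open>*\<close> applies in one of
      the two orders.\<close>
    show ?thesis
      using *[of i j] *[of j i] q_neq[OF ij] ij coprime_commute by metis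
  qed
  have R15: "coprime (R i) 15" if i: "i \<in> set cover" for i
  proof (cases "q i = 7")
    case True
    have "coprime (337::nat) 15" by (simp add: coprime_iff_gcd_eq_1 gcd_non_0_nat)
    thus ?thesis using R(3)[OF i True] by simp
  next
    case False
    have "odd (q i)" using q(2)[OF i] by presburger
    hence "coprime (q i) 2" by simp
    \<comment> \<open>Here 15 arises as \<open>4 ^ 2 - 1\<close>, so the exponent is 2.\<close>
    thus ?thesis using R_coprime[OF i False, of 2 15] by simp
  qed
  have q15: "coprime (q i) 15" if i: "i \<in> set cover" for i
  proof (cases "q i = 7")
    case True
    have "coprime (7::nat) 15" by (simp add: coprime_iff_gcd_eq_1 gcd_non_0_nat)
    thus ?thesis using True by simp
  next
    case False
    hence "coprime (q i) 945" using q(5)[OF i] by blast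
    thus ?thesis using coprime_divisors[of "q i" "q i" 15 945] by simp
  qed
  have odd_R: "odd (R i)" if i: "i \<in> set cover" for i
  proof -
    have "m i > 0" using q(4)[OF i] by (cases "m i = 0") auto
    hence "m i * q i > 0" using q(1)[OF i] prime_gt_0_nat by simp
    hence "odd ((4::nat) ^ (m i * q i) - 1)" by simp
    thus ?thesis using R(2)[OF i] dvd_trans by blast
  qed
  have R_cong: "[4 ^ (m i * q i) = 1] (mod R i)" if "i \<in> set cover" for i
    using R(2)[OF that] four_power_minus_one_dvd by blast
  show ?thesis
  proof (rule exI[of _ q], rule exI[of _ R], intro conjI ballI impI)
    fix i assume i: "i \<in> set cover"
    show "prime (q i)" "q i mod 4 = 3" "[4 ^ fst (snd i) = 1] (mod q i)" "odd (R i)" "R i > 1"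
      "[4 ^ (fst (snd i) * q i) = 1] (mod R i)" "coprime (q i) (R i)" "coprime (q i) 15"
      "coprime (R i) 15"
      using q(1-3)[OF i] odd_R[OF i] R(1)[OF i] R_cong[OF i] qR[OF i i] q15[OF i] R15[OF i]
      unfolding m_def by simp_all
  next
    fix i j assume i: "i \<in> set cover" and j: "j \<in> set cover" "i \<noteq> j"
    show "coprime (q i) (q j)" "coprime (q i) (R j)" "coprime (R i) (R j)"
      using prime_coprime[OF q(1)[OF i] q(1)[OF j(1)] q_neq[OF i j]] qR[OF i j(1)] RR[OF i j]
      by simp_all
  qed
qed

section \<open>Gluing the residues by the Chinese remainder theorem\<close>

theorem theorem3:
  shows "\<exists>M \<alpha> :: int. M > 0 \<and> odd M \<and>
    {x :: int. [x = \<alpha>] (mod M)} \<inter>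
    {int p ^ 2 + int b ^ 2 - 2 ^ n | (p :: nat) (b :: nat) (n :: nat). prime p} = {}"
proof -
  obtain q R where qR: "\<And>i. i \<in> set cover \<Longrightarrow> prime (q i) \<and> q i mod 4 = 3 \<and>
          [4 ^ fst (snd i) = 1] (mod q i) \<and> odd (R i) \<and> R i > 1 \<and>
          [4 ^ (fst (snd i) * q i) = 1] (mod R i) \<and>
          coprime (q i) (R i) \<and> coprime (q i) 15 \<and> coprime (R i) 15"
      and cop: "\<And>i j. i \<in> set cover \<Longrightarrow> j \<in> set cover \<Longrightarrow> i \<noteq> j \<Longrightarrow>
          coprime (q i) (q j) \<and> coprime (q i) (R j) \<and> coprime (R i) (R j :: nat)"
    using ex_coprime_moduli by blast
  define Q where "Q = (\<lambda>i. (q i)\<^sup>2 * R i)"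
  have "\<forall>i\<in>set cover. \<exists>u::nat. \<forall>x k p b. [x = int u] (mod int (Q i)) \<longrightarrow>
      k mod fst (snd i) = fst i mod fst (snd i) \<longrightarrow> prime p \<longrightarrow>
      x + 4 ^ k \<noteq> int p ^ 2 + int b ^ 2"
    unfolding Q_def using ex_residue_even_class qR by blast
  then obtain u where u: "\<And>i x k p b. i \<in> set cover \<Longrightarrow> [x = int (u i)] (mod int (Q i)) \<Longrightarrow>
      k mod fst (snd i) = fst i mod fst (snd i) \<Longrightarrow> prime p \<Longrightarrow>
      x + 4 ^ k \<noteq> int p ^ 2 + int b ^ 2"
    by metis
  have "\<forall>i\<in>set cover. \<forall>j\<in>set cover. i \<noteq> j \<longrightarrow> coprime (Q i) (Q j)"
    using cop unfolding Q_def by (auto simp: coprime_commute)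
  then obtain w where w: "\<forall>i\<in>set cover. [w = u i] (mod Q i)"
    using chinese_remainder_nat[of "set cover" Q u] by auto
  define P where "P = (\<Prod>i\<in>set cover. Q i)"
  have Q15: "coprime (Q i) 15" if "i \<in> set cover" for i using qR[OF that] by (simp add: Q_def)
  hence "coprime P 15" unfolding P_def by (intro prod_coprime_left)
  \<comment> \<open>The factor 15 handles odd exponents and \<open>P\<close> the even ones.\<close>
  then obtain z where z: "[z = w] (mod P)" "[z = 4] (mod 15)"
    using binary_chinese_remainder_nat by blast
  have odd_Q: "odd (Q i)" if "i \<in> set cover" for i
  proof -
    have "q i mod 4 = 3" using qR[OF that] by blast
    hence "odd (q i)" by presburger
    thus ?thesis using qR[OF that] by (simp add: Q_def)
  qed
  have "odd P" unfolding P_def using odd_Q by (simp add: even_prod_iff)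
  define M where "M = int (P * 15)"
  have M: "M > 0" "odd M" using \<open>odd P\<close> by (auto simp: M_def intro: odd_pos)
  have "x \<noteq> int p ^ 2 + int b ^ 2 - 2 ^ n" if x: "[x = int z] (mod M)" and p: "prime p" for x p b n
  proof (cases "even n")
    case False
    have "[x = int z] (mod 15)" using x by (rule cong_dvd_modulus) (simp add: M_def)
    moreover have "[int z = 4] (mod 15)" using z(2) by (simp flip: cong_int_iff)
    ultimately have "[x = 4] (mod 15)" using cong_trans by blast
    from odd_exponent[OF this False p, of b] show ?thesis by auto
  next
    case True
    then obtain k where k: "n = 2 * k" by blast
    obtain i where i: "i \<in> set cover" "k mod fst (snd i) = fst i mod fst (snd i)"
      using ex_cover_class[of k] by fastforce
    have "Q i dvd P" unfolding P_def using i(1) by (intro dvd_prodI) simp_all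
    hence "[z = w] (mod Q i)" using z(1) cong_dvd_modulus_nat by blast
    hence "[z = u i] (mod Q i)" using w i(1) cong_trans by blast
    hence "[int z = int (u i)] (mod int (Q i))" by (simp only: cong_int_iff)
    moreover have "int (Q i) dvd M" using \<open>Q i dvd P\<close> by (simp only: M_def int_dvd_int_iff dvd_mult2)
    hence "[x = int z] (mod int (Q i))" using x cong_dvd_modulus by blast
    ultimately have "[x = int (u i)] (mod int (Q i))" using cong_trans by blast
    from u[OF i(1) this i(2) p, of b] show ?thesis by (auto simp: k power_mult)
  qed
  hence "{x. [x = int z] (mod M)} \<inter>
      {int p ^ 2 + int b ^ 2 - 2 ^ n | (p :: nat) (b :: nat) (n :: nat). prime p} = {}"
    by blast
  with M show ?thesis by blast
qed
end
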